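(* Let $G$ be a finite group, let $R\subseteq G$ be a subset that is both Eulerian (for every $r\in R$, every $x\in G$ with $\langle x\rangle=\langle r\rangle$ belongs to $R$) and normal ($g^{-1}rg\in R$ for all $r\in R$, $g\in G$), and let $H$ be a subgroup of $G$. Put $S=R\setminus(R\cap H)$. Then the Cayley graph $\mathrm{Cay}(G,S)$ is integral, i.e. every eigenvalue of its adjacency matrix is an integer.
   Context: All groups and graphs are finite. For a group $G$ and a subset $S\subseteq G$ with $1\notin S$ and $S=S^{-1}$, where $S^{-1}=\{s^{-1}\mid s\in S\}$, the Cayley graph $\mathrm{Cay}(G,S)$ is the undirected loopless graph with vertex set $G$ and edge set $\{(g,gs)\mid g\in G,\ s\in S\}$. Its adjacency matrix is the complex matrix $(a_{g,h})$ with rows and columns indexed by $G$, where $a_{g,h}=1$ if $(g,h)$ is an edge and $a_{g,h}=0$ otherwise. *)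

theory Defs
  imports
    "HOL-Algebra.Coset"
    "HOL-Algebra.Generated_Groups"
    "Graph_Theory.Pair_Digraph"
    "Jordan_Normal_Form.Char_Poly"
begin

definition eulerian_subset :: "('a, 'b) monoid_scheme \<Rightarrow> 'a set \<Rightarrow> bool" where
  "eulerian_subset G R \<longleftrightarrow> R \<subseteq> carrier G \<and>
     (\<forall>r\<in>R. \<forall>x\<in>carrier G. generate G {x} = generate G {r} \<longrightarrow> x \<in> R)"

definition normal_subset :: "('a, 'b) monoid_scheme \<Rightarrow> 'a set \<Rightarrow> bool" where
  "normal_subset G R \<longleftrightarrow> R \<subseteq> carrier G \<and>
     (\<forall>r\<in>R. \<forall>g\<in>carrier G. inv\<^bsub>G\<^esub> g \<otimes>\<^bsub>G\<^esub> r \<otimes>\<^bsub>G\<^esub> g \<in> R)"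

definition connection_set :: "('a, 'b) monoid_scheme \<Rightarrow> 'a set \<Rightarrow> bool" where
  "connection_set G S \<longleftrightarrow> S \<subseteq> carrier G \<and> \<one>\<^bsub>G\<^esub> \<notin> S \<and> S = set_inv\<^bsub>G\<^esub> S"

text \<open>
  An undirected edge is represented by its two opposite arcs. The result is a
  finite simple undirected graph (a \<open>pair_graph\<close>) only for connection sets,
  see \<open>cayley_graph_pair_graph\<close> below.
\<close>

definition cayley_graph :: "('a, 'b) monoid_scheme \<Rightarrow> 'a set \<Rightarrow> 'a pair_pre_digraph" where
  "cayley_graph G S =
     \<lparr> pverts = carrier G, parcs = {(g, g \<otimes>\<^bsub>G\<^esub> s) |g s. g \<in> carrier G \<and> s \<in> S} \<rparr>"

text \<open>
  Matrices have index set \<open>{0..<n}\<close>, so the adjacency matrix is taken relative to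
  an enumeration \<open>vs\<close> of the vertices, used for both rows and columns.
  Changing the enumeration conjugates the matrix by a permutation matrix;
  integrality is required for every enumeration.
\<close>

definition adjacency_matrix :: "'a pair_pre_digraph \<Rightarrow> 'a list \<Rightarrow> complex mat" where
  "adjacency_matrix \<Gamma> vs = mat (length vs) (length vs)
     (\<lambda>(i, j). if (vs ! i, vs ! j) \<in> parcs \<Gamma> then 1 else 0)"

definition integral_graph :: "'a pair_pre_digraph \<Rightarrow> bool" where
  "integral_graph \<Gamma> \<longleftrightarrow> (\<forall>vs. distinct vs \<and> set vs = pverts \<Gamma> \<longrightarrow>
     (\<forall>k. eigenvalue (adjacency_matrix \<Gamma> vs) k \<longrightarrow> k \<in> \<int>))"

lemma cayley_graph_pair_graph:
  assumes "group G" "finite (carrier G)" "connection_set G S"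
  shows "pair_graph (cayley_graph G S)"
proof -
  interpret group G by fact
  have S: "S \<subseteq> carrier G" "\<one>\<^bsub>G\<^esub> \<notin> S" "S = set_inv\<^bsub>G\<^esub> S"
    using assms(3) by (auto simp: connection_set_def)
  have arcs: "parcs (cayley_graph G S) \<subseteq> carrier G \<times> carrier G"
    using S(1) by (auto simp: cayley_graph_def)
  show ?thesis
  proof unfold_locales
    show "finite (pverts (cayley_graph G S))"
      using assms(2) by (simp add: cayley_graph_def)
    show "finite (parcs (cayley_graph G S))"
      using arcs assms(2) by (meson finite_SigmaI finite_subset)
    show "fst e \<in> pverts (cayley_graph G S)" "snd e \<in> pverts (cayley_graph G S)"
      if "e \<in> parcs (cayley_graph G S)" for e
      using that S(1) by (auto simp: cayley_graph_def)
    show "fst e \<noteq> snd e" if "e \<in> parcs (cayley_graph G S)" for e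
      using that S(1,2) by (auto simp: cayley_graph_def)
    have "(g \<otimes>\<^bsub>G\<^esub> s, g) \<in> parcs (cayley_graph G S)" if "g \<in> carrier G" "s \<in> S" for g s
    proof -
      have s: "s \<in> carrier G" using S(1) that(2) by blast
      have "inv\<^bsub>G\<^esub> s \<in> S" using S(3) that(2) by (auto simp: SET_INV_def)
      then have "(g \<otimes>\<^bsub>G\<^esub> s, g \<otimes>\<^bsub>G\<^esub> s \<otimes>\<^bsub>G\<^esub> inv\<^bsub>G\<^esub> s) \<in> parcs (cayley_graph G S)"
        using that(1) s unfolding cayley_graph_def by (simp, blast)
      then show ?thesis using that(1) s by (simp add: m_assoc)
    qed
    then have "sym (parcs (cayley_graph G S))"
      by (intro symI) (auto simp: cayley_graph_def)
    then show "symmetric (with_proj (cayley_graph G S))"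
      by (simp add: symmetric_def)
  qed
qed

lemma connection_set_eulerian_diff:
  assumes "group G" "eulerian_subset G R" "subgroup H G"
  shows "connection_set G (R - (R \<inter> H))"
proof -
  interpret group G by fact
  interpret H: subgroup H G by fact
  have R: "R \<subseteq> carrier G" using assms(2) by (simp add: eulerian_subset_def)
  have le: "generate G {x} \<subseteq> generate G {y}"
    if "x \<in> generate G {y}" "y \<in> carrier G" for x y
    by (rule generate_subgroup_incl) (use that generate_is_subgroup[of "{y}"] in auto)
  have gen: "generate G {inv\<^bsub>G\<^esub> r} = generate G {r}" if r: "r \<in> carrier G" for r
  proof (rule equalityI; rule le)
    show "inv\<^bsub>G\<^esub> r \<in> generate G {r}"
      by (rule generate.inv) simp
    have "inv\<^bsub>G\<^esub> (inv\<^bsub>G\<^esub> r) \<in> generate G {inv\<^bsub>G\<^esub> r}"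
      by (rule generate.inv) simp
    then show "r \<in> generate G {inv\<^bsub>G\<^esub> r}"
      using r by simp
  qed (use r in simp_all)
  have inv: "inv\<^bsub>G\<^esub> r \<in> R - (R \<inter> H)" if "r \<in> R - (R \<inter> H)" for r
  proof -
    have r: "r \<in> R" "r \<notin> H" "r \<in> carrier G" using that R by auto
    have "inv\<^bsub>G\<^esub> r \<in> R"
      using assms(2) gen[OF r(3)] r(1) inv_closed[OF r(3)] unfolding eulerian_subset_def by blast
    moreover have "inv\<^bsub>G\<^esub> r \<notin> H"
      using H.m_inv_closed[of "inv\<^bsub>G\<^esub> r"] r by auto
    ultimately show ?thesis by blast
  qed
  have "R - (R \<inter> H) = set_inv\<^bsub>G\<^esub> (R - (R \<inter> H))"
  proof
    show "set_inv\<^bsub>G\<^esub> (R - (R \<inter> H)) \<subseteq> R - (R \<inter> H)"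
      using inv by (auto simp: SET_INV_def)
    show "R - (R \<inter> H) \<subseteq> set_inv\<^bsub>G\<^esub> (R - (R \<inter> H))"
    proof
      fix r assume r: "r \<in> R - (R \<inter> H)"
      then have "inv\<^bsub>G\<^esub> (inv\<^bsub>G\<^esub> r) = r" using R by auto
      with inv[OF r] show "r \<in> set_inv\<^bsub>G\<^esub> (R - (R \<inter> H))"
        unfolding SET_INV_def by force
    qed
  qed
  moreover have "R - (R \<inter> H) \<subseteq> carrier G" "\<one>\<^bsub>G\<^esub> \<notin> R - (R \<inter> H)"
    using R H.one_closed by auto
  ultimately show ?thesis unfolding connection_set_def by (intro conjI)
qed

end

theory Submission
  imports Defs "Jordan_Normal_Form.Schur_Decomposition" "HOL-Library.Indicator_Function"
begin

text \<open>
  The adjacency matrix of \<open>Cay(G, S)\<close> is \<open>A R - A (R \<inter> H)\<close>, where \<open>A T\<close> denotes right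
  multiplication by \<open>\<Sum>t\<in>T. t\<close> on the group algebra. As \<open>R\<close> is normal, \<open>A R\<close> is central, so each
  eigenvalue is a difference of eigenvalues of \<open>A R\<close> and \<open>A (R \<inter> H)\<close>. Both sets are Eulerian and
  stable under conjugation by a subgroup containing them (\<open>G\<close> and \<open>H\<close>), and then every eigenvalue
  \<open>k\<close> of \<open>A T\<close> is an integer: the \<open>k\<close>-eigenspace is invariant under that subgroup, so comparing
  traces on it shows that \<open>k\<close> times its dimension is the sum of the character values at \<open>t \<in> T\<close>.
  Over a whole cyclic group \<open>C\<close> the values of a character sum to \<open>|C|\<close> times the trace of a
  projection, hence by induction on \<open>|C|\<close> their sum over the generators of \<open>C\<close> is rational,
  and \<open>T\<close> is a union of such sets of generators. So \<open>k\<close> is a rational algebraic integer.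
\<close>

section \<open>Traces and eigenspaces of complex matrices\<close>

definition mat_trace :: "'a :: comm_monoid_add mat \<Rightarrow> 'a" where
  "mat_trace A = (\<Sum>i<dim_row A. A $$ (i, i))"

lemma mat_trace_add:
  assumes "A \<in> carrier_mat n n" "B \<in> carrier_mat n n"
  shows "mat_trace (A + B) = mat_trace A + mat_trace B"
  using assms by (simp add: mat_trace_def sum.distrib)

lemma mat_trace_smult:
  fixes A :: "'a :: comm_semiring_0 mat"
  assumes "A \<in> carrier_mat n n"
  shows "mat_trace (c \<cdot>\<^sub>m A) = c * mat_trace A"
  using assms by (simp add: mat_trace_def sum_distrib_left)

lemma index_mult_mat_sum:
  assumes "A \<in> carrier_mat n m" "B \<in> carrier_mat m l" "i < n" "j < l"
  shows "(A * B) $$ (i, j) = (\<Sum>k<m. A $$ (i, k) * B $$ (k, j))"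
  using assms by (auto simp: scalar_prod_def atLeast0LessThan intro!: sum.cong)

lemma mat_trace_mult:
  fixes A :: "'a :: comm_semiring_0 mat"
  assumes "A \<in> carrier_mat n m" "B \<in> carrier_mat m n"
  shows "mat_trace (A * B) = (\<Sum>i<n. \<Sum>j<m. A $$ (i, j) * B $$ (j, i))"
  using assms by (auto simp: mat_trace_def scalar_prod_def atLeast0LessThan intro!: sum.cong)

lemma mat_trace_mult_commute:
  fixes A :: "'a :: comm_semiring_0 mat"
  assumes "A \<in> carrier_mat n m" "B \<in> carrier_mat m n"
  shows "mat_trace (A * B) = mat_trace (B * A)"
  unfolding mat_trace_mult[OF assms] mat_trace_mult[OF assms(2,1)]
  by (subst sum.swap) (simp add: mult.commute)

text \<open>Schur decomposition makes \<open>A\<close> similar to a matrix whose diagonal lists the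
  roots of the characteristic polynomial with multiplicity, and the trace is invariant under
  similarity.\<close>

lemma mat_trace_eq_sum_eigenvalues:
  fixes A :: "complex mat"
  assumes A: "A \<in> carrier_mat n n"
  obtains es where "length es = n" "mat_trace A = sum_list es" "\<And>e. e \<in> set es \<Longrightarrow> eigenvalue A e"
proof -
  obtain es where es: "char_poly A = (\<Prod>a\<leftarrow>es. [:- a, 1:])" "length es = n"
    using char_poly_factorized[OF A] by blast
  obtain B P Q where s: "schur_decomposition A es = (B, P, Q)"
    by (cases "schur_decomposition A es") auto
  note sd = schur_decomposition[OF A es(1) s]
  then have c: "B \<in> carrier_mat n n" "P \<in> carrier_mat n n" "Q \<in> carrier_mat n n"
    and QP: "Q * P = 1\<^sub>m n" and AB: "A = P * B * Q"
    using similar_mat_witD2[OF A] by auto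
  have "mat_trace A = mat_trace (Q * (P * B))"
    unfolding AB using c by (intro mat_trace_mult_commute[of _ n n]) auto
  also have "Q * (P * B) = B"
    using c QP by (simp flip: assoc_mult_mat[of Q n n P n B n])
  also have "mat_trace B = sum_list (diag_mat B)"
    by (simp add: mat_trace_def diag_mat_def interv_sum_list_conv_sum_set_nat atLeast0LessThan)
  finally have "mat_trace A = sum_list es" using sd by simp
  moreover have "eigenvalue A e" if "e \<in> set es" for e
    using that unfolding eigenvalue_root_char_poly[OF A] es(1)
    by (auto simp: poly_prod_list prod_list_zero_iff)
  ultimately show thesis using that es(2) by blast
qed

section \<open>Eigenvectors in matrix form\<close>

lemma smult_minus_distrib_mat:
  fixes A :: "'a :: ring mat"
  assumes "A \<in> carrier_mat n m" "B \<in> carrier_mat n m"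
  shows "k \<cdot>\<^sub>m (A - B) = k \<cdot>\<^sub>m A - k \<cdot>\<^sub>m B"
  using assms by (intro eq_matI) (auto simp: right_diff_distrib)

lemma eigenvalue_matI:
  fixes A X :: "'a :: comm_ring_1 mat"
  assumes "A \<in> carrier_mat n n" "X \<in> carrier_mat n m" "X \<noteq> 0\<^sub>m n m" "A * X = k \<cdot>\<^sub>m X"
  shows "eigenvalue A k"
proof -
  obtain i j where ij: "i < n" "j < m" "X $$ (i, j) \<noteq> 0"
    using assms(2,3) by (auto simp: mat_eq_iff)
  have "A *\<^sub>v col X j = col (A * X) j"
    using assms(1,2) ij by (auto intro!: eq_vecI)
  also have "\<dots> = k \<cdot>\<^sub>v col X j" using assms(2,4) ij by auto
  finally have "eigenvector A (col X j) k"
    using assms(1,2) ij unfolding eigenvector_def by (auto simp: vec_eq_iff intro!: exI[of _ i])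
  then show ?thesis unfolding eigenvalue_def ..
qed

text \<open>An eigenvector copied into every column gives a square matrix, so that the later
  arguments can be carried out by multiplying square matrices of one size.\<close>

lemma eigenvalue_matE:
  fixes A :: "'a :: comm_ring_1 mat"
  assumes "A \<in> carrier_mat n n" "eigenvalue A k"
  obtains X where "X \<in> carrier_mat n n" "X \<noteq> 0\<^sub>m n n" "A * X = k \<cdot>\<^sub>m X"
proof -
  obtain v where v: "v \<in> carrier_vec n" "v \<noteq> 0\<^sub>v n" "A *\<^sub>v v = k \<cdot>\<^sub>v v"
    using assms unfolding eigenvalue_def eigenvector_def by auto
  define X where "X = mat n n (\<lambda>(i, j). v $ i)"
  have X: "X \<in> carrier_mat n n" by (simp add: X_def)
  obtain i where i: "i < n" "v $ i \<noteq> 0" using v(1,2) by (auto simp: vec_eq_iff)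
  have "X $$ (i, i) \<noteq> 0" using i by (simp add: X_def)
  then have "X \<noteq> 0\<^sub>m n n" using i by (metis index_zero_mat(1))
  moreover have "A * X = k \<cdot>\<^sub>m X"
  proof (rule eq_matI)
    fix i j assume ij: "i < dim_row (k \<cdot>\<^sub>m X)" "j < dim_col (k \<cdot>\<^sub>m X)"
    then have ij: "i < n" "j < n" by (simp_all add: X_def)
    have "col X j = v" using v(1) ij by (intro eq_vecI) (simp_all add: X_def)
    then have "(A * X) $$ (i, j) = (A *\<^sub>v v) $ i"
      using ij assms(1) X by simp
    also have "\<dots> = (k \<cdot>\<^sub>m X) $$ (i, j)"
      unfolding v(3) using ij v(1) by (simp add: X_def)
    finally show "(A * X) $$ (i, j) = (k \<cdot>\<^sub>m X) $$ (i, j)" .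
  qed (use assms(1) X in auto)
  ultimately show thesis using that[OF X] by blast
qed

section \<open>Idempotents and projections onto eigenspaces\<close>

lemma idempotent_mat_eigenvalue:
  fixes E :: "'a :: field mat"
  assumes "E \<in> carrier_mat n n" "E * E = E" "eigenvalue E e"
  shows "e = 0 \<or> e = 1"
proof -
  obtain X where X: "X \<in> carrier_mat n n" "X \<noteq> 0\<^sub>m n n" "E * X = e \<cdot>\<^sub>m X"
    using eigenvalue_matE assms(1,3) by blast
  have "e \<cdot>\<^sub>m X = E * (E * X)"
    using assoc_mult_mat[OF assms(1,1) X(1)] assms(2) X(3) by metis
  also have "\<dots> = e \<cdot>\<^sub>m (e \<cdot>\<^sub>m X)"
    unfolding X(3) mult_smult_distrib[OF assms(1) X(1)] ..
  also have "\<dots> = e * e \<cdot>\<^sub>m X" by (intro eq_matI) auto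
  finally have eq: "e \<cdot>\<^sub>m X = e * e \<cdot>\<^sub>m X" .
  obtain i j where ij: "i < n" "j < n" "X $$ (i, j) \<noteq> 0"
    using X(1,2) by (auto simp: mat_eq_iff)
  have "(e \<cdot>\<^sub>m X) $$ (i, j) = (e * e \<cdot>\<^sub>m X) $$ (i, j)" using eq by simp
  then show ?thesis using ij X(1) by simp
qed

text \<open>Only 0 and 1 occur as eigenvalues, so the trace counts the eigenvalue 1 with
  multiplicity. Traces thus stand in for dimensions, and the bound \<open>m \<le> n\<close> allows a
  maximal idempotent to be chosen.\<close>

lemma idempotent_mat_trace:
  fixes E :: "complex mat"
  assumes "E \<in> carrier_mat n n" "E * E = E"
  obtains m where "m \<le> n" "mat_trace E = of_nat m"
proof -
  obtain es where es: "length es = n" "mat_trace E = sum_list es"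
    "\<And>e. e \<in> set es \<Longrightarrow> eigenvalue E e"
    using mat_trace_eq_sum_eigenvalues[OF assms(1)] by blast
  have "\<forall>e\<in>set es. e = 0 \<or> e = 1"
    using es(3) idempotent_mat_eigenvalue[OF assms] by blast
  then have "\<exists>m\<le>length es. sum_list es = of_nat m"
  proof (induction es)
    case (Cons e es)
    then obtain m where "m \<le> length es" "sum_list es = of_nat m" by auto
    then show ?case using Cons.prems
      by (auto intro: exI[of _ m] exI[of _ "Suc m"])
  qed simp
  then show thesis using that es by auto
qed

text \<open>The defect \<open>W = X - E * X\<close> is nonzero, is killed by \<open>E\<close> and
  still satisfies \<open>A * W = k \<cdot>\<^sub>m W\<close>. A rank-one idempotent with image
  spanned by a column of \<open>W\<close>, orthogonal to \<open>E\<close> on both sides, can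
  therefore be added to \<open>E\<close>.\<close>

lemma eigenspace_idempotent_extend:
  fixes A E X :: "'a :: field mat"
  assumes A: "A \<in> carrier_mat n n" and E: "E \<in> carrier_mat n n" "E * E = E" "A * E = k \<cdot>\<^sub>m E"
    and X: "X \<in> carrier_mat n n" "A * X = k \<cdot>\<^sub>m X" "E * X \<noteq> X"
  obtains E' where "E' \<in> carrier_mat n n" "E' * E' = E'" "A * E' = k \<cdot>\<^sub>m E'"
    "mat_trace E' = mat_trace E + 1"
proof -
  note assoc = assoc_mult_mat[of _ n n _ n _ n]
  define W where "W = X - E * X"
  define I where "I = 1\<^sub>m n - E"
  have W: "W \<in> carrier_mat n n" and I: "I \<in> carrier_mat n n"
    using E X by (auto simp: W_def I_def)
  have EEX: "E * (E * X) = E * X"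
    using assoc[OF E(1) E(1) X(1)] E(2) by simp
  have AEX: "A * (E * X) = k \<cdot>\<^sub>m (E * X)"
    using assoc[OF A E(1) X(1)] E(3) mult_smult_assoc_mat[OF E(1) X(1)] by simp
  have EX: "E * X \<in> carrier_mat n n" using E X by simp
  have EW: "E * W = 0\<^sub>m n n"
    unfolding W_def mult_minus_distrib_mat[OF E(1) X(1) EX] EEX using EX by simp
  have "A * W = k \<cdot>\<^sub>m X - k \<cdot>\<^sub>m (E * X)"
    unfolding W_def mult_minus_distrib_mat[OF A X(1) EX] AEX X(2) ..
  also have "\<dots> = k \<cdot>\<^sub>m W"
    unfolding W_def by (rule smult_minus_distrib_mat[symmetric, OF X(1) EX])
  finally have AW: "A * W = k \<cdot>\<^sub>m W" .
  have IE: "I * E = 0\<^sub>m n n"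
    unfolding I_def minus_mult_distrib_mat[OF one_carrier_mat E(1) E(1)] using E by simp
  have IW: "I * W = W"
    unfolding I_def minus_mult_distrib_mat[OF one_carrier_mat E(1) W] EW
    using W by (intro eq_matI) auto
  obtain i j where ij: "i < n" "j < n" "W $$ (i, j) \<noteq> 0"
    using E X by (auto simp: mat_eq_iff W_def)
  \<comment> \<open>A matrix unit scaled by the inverse of a nonzero entry of \<open>W\<close>: this
    gives \<open>D * W * D = D\<close> and makes the trace of \<open>D * W\<close> equal to
    1.\<close>
  define D where "D = mat n n (\<lambda>(a, b). if a = j \<and> b = i then 1 / W $$ (i, j) else 0)"
  have D: "D \<in> carrier_mat n n" by (simp add: D_def)
  have D_ab: "D $$ (a, b) = (if a = j \<and> b = i then 1 / W $$ (i, j) else 0)"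
    if "a < n" "b < n" for a b
    using that by (simp add: D_def)
  have DW: "(D * W) $$ (a, b) = (if a = j then W $$ (i, b) / W $$ (i, j) else 0)"
    if "a < n" "b < n" for a b
  proof -
    have "(D * W) $$ (a, b) = (\<Sum>c<n. D $$ (a, c) * W $$ (c, b))"
      using that W D by (intro index_mult_mat_sum) auto
    also have "\<dots> = (\<Sum>c<n. if c = i then (if a = j then W $$ (i, b) / W $$ (i, j) else 0) else 0)"
      using that by (intro sum.cong) (auto simp: D_ab)
    finally show ?thesis using ij by simp
  qed
  have "D * W * D = D"
  proof (rule eq_matI)
    fix a b assume ab: "a < dim_row D" "b < dim_col D"
    then have ab: "a < n" "b < n" using D by auto
    have "(D * W * D) $$ (a, b) = (\<Sum>c<n. (D * W) $$ (a, c) * D $$ (c, b))"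
      using ab W D by (intro index_mult_mat_sum) auto
    also have "\<dots> = (\<Sum>c<n. if c = j then (if a = j \<and> b = i then 1 / W $$ (i, j) else 0) else 0)"
      using ab ij by (intro sum.cong) (auto simp: DW D_ab)
    finally show "(D * W * D) $$ (a, b) = D $$ (a, b)" using ab ij by (simp add: D_ab)
  qed (use W D in auto)
  then have DWD: "D * (W * D) = D" using W D by (simp add: assoc)
  have "mat_trace (D * W) = (\<Sum>a<n. if a = j then W $$ (i, a) / W $$ (i, j) else 0)"
    using D DW by (simp add: mat_trace_def)
  then have trDW: "mat_trace (D * W) = 1" using ij by simp
  \<comment> \<open>\<open>F\<close> is the rank-one projection onto column \<open>j\<close> of \<open>W\<close> along the hyperplane
    annihilated by row \<open>i\<close> of \<open>I\<close>.\<close>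
  define F where "F = W * (D * I)"
  have F: "F \<in> carrier_mat n n" using W D I by (simp add: F_def)
  have DI: "D * I \<in> carrier_mat n n" and WD: "W * D \<in> carrier_mat n n" using W D I by auto
  have F_eq: "F = W * D * I" unfolding F_def by (rule assoc[OF W D I, symmetric])
  have EF: "E * F = 0\<^sub>m n n"
    unfolding F_def assoc[OF E(1) W DI, symmetric] EW using DI by (rule left_mult_zero_mat)
  have IF: "I * F = F"
    unfolding F_def assoc[OF I W DI, symmetric] IW ..
  have AF: "A * F = k \<cdot>\<^sub>m F"
    unfolding F_def assoc[OF A W DI, symmetric] AW by (rule mult_smult_assoc_mat[OF W DI])
  have FE: "F * E = 0\<^sub>m n n"
    unfolding F_eq assoc[OF WD I E(1)] IE using WD by (rule right_mult_zero_mat)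
  have "F * F = W * D * (I * F)"
    by (subst F_eq) (rule assoc[OF WD I F])
  also have "\<dots> = W * D * (W * (D * I))" unfolding IF by (simp only: F_def)
  also have "\<dots> = W * (D * (W * (D * I)))" by (rule assoc[OF W D]) (use F F_def in simp)
  also have "D * (W * (D * I)) = D * (W * D) * I"
    unfolding assoc[OF W D I, symmetric] by (rule assoc[OF D WD I, symmetric])
  finally have FF: "F * F = F" unfolding DWD F_def .
  have "mat_trace F = mat_trace (D * I * W)"
    unfolding F_def by (rule mat_trace_mult_commute[OF W DI])
  then have trF: "mat_trace F = 1" unfolding assoc[OF D I W] IW trDW .
  show thesis
  proof
    show "(E + F) * (E + F) = E + F"
      using E F EF FE FF
      by (simp add: add_mult_distrib_mat[of _ n n _ _ n] mult_add_distrib_mat[of _ n n _ n])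
    show "A * (E + F) = k \<cdot>\<^sub>m (E + F)"
      using A E F AF
      by (simp add: mult_add_distrib_mat[of _ n n _ n] add_smult_distrib_left_mat)
    show "mat_trace (E + F) = mat_trace E + 1"
      using E F trF by (simp add: mat_trace_add)
  qed (use E F in auto)
qed

text \<open>Among the idempotents whose image lies in the eigenspace, take one of greatest trace. If
  it failed to fix some \<open>X\<close> with columns in the eigenspace, it could be extended; so it
  projects onto the whole eigenspace, and \<open>m\<close> is the dimension.\<close>

lemma eigenspace_projection:
  fixes A :: "complex mat"
  assumes A: "A \<in> carrier_mat n n" and k: "eigenvalue A k"
  obtains E m where "E \<in> carrier_mat n n" "E * E = E" "A * E = k \<cdot>\<^sub>m E"
    "mat_trace E = of_nat m" "m > 0"
    "\<And>X. X \<in> carrier_mat n n \<Longrightarrow> A * X = k \<cdot>\<^sub>m X \<Longrightarrow> E * X = X"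
proof -
  define P where "P m \<longleftrightarrow> (\<exists>E. E \<in> carrier_mat n n \<and> E * E = E \<and> A * E = k \<cdot>\<^sub>m E \<and>
    mat_trace E = of_nat m)" for m
  have P_le: "m \<le> n" if Pm: "P m" for m
  proof -
    obtain E :: "complex mat" where "E \<in> carrier_mat n n" "E * E = E" "mat_trace E = of_nat m"
      using Pm unfolding P_def by blast
    then show ?thesis by (elim idempotent_mat_trace) simp_all
  qed
  have ext: "P (Suc m)" if E: "E \<in> carrier_mat n n" "E * E = E" "A * E = k \<cdot>\<^sub>m E"
    "mat_trace E = of_nat m" and X: "X \<in> carrier_mat n n" "A * X = k \<cdot>\<^sub>m X" "E * X \<noteq> X" for E X m
  proof -
    obtain E' where "E' \<in> carrier_mat n n" "E' * E' = E'" "A * E' = k \<cdot>\<^sub>m E'"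
      "mat_trace E' = mat_trace E + 1"
      using eigenspace_idempotent_extend[OF A E(1,2,3) X] by blast
    then show ?thesis unfolding P_def using E(4) by (intro exI[of _ E']) simp
  qed
  obtain X where X: "X \<in> carrier_mat n n" "X \<noteq> 0\<^sub>m n n" "A * X = k \<cdot>\<^sub>m X"
    using eigenvalue_matE[OF A k] by blast
  \<comment> \<open>Extending the zero idempotent by an eigenvector shows that the greatest trace is
    positive.\<close>
  have P1: "P (Suc 0)"
    using X A by (intro ext[of "0\<^sub>m n n" 0 X]) (auto simp: mat_trace_def)
  define m where "m = Greatest P"
  have m: "P m" "P l \<Longrightarrow> l \<le> m" for l
    unfolding m_def using GreatestI_nat[of P "Suc 0" n] Greatest_le_nat[of P l n] P1 P_le by blast+
  then obtain E where E: "E \<in> carrier_mat n n" "E * E = E" "A * E = k \<cdot>\<^sub>m E"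
    "mat_trace E = of_nat m"
    unfolding P_def by blast
  show thesis
  proof (rule that[OF E])
    show "m > 0" using m(2)[OF P1] by simp
    show "E * X = X" if "X \<in> carrier_mat n n" "A * X = k \<cdot>\<^sub>m X" for X
      using ext[OF E that] m(2) by fastforce
  qed
qed

section \<open>Algebraic integrality and common eigenvectors\<close>

text \<open>The characteristic polynomial is the image of that of an integer matrix, hence monic
  with integer coefficients.\<close>

lemma eigenvalue_algebraic_int:
  fixes A :: "complex mat"
  assumes A: "A \<in> carrier_mat n n" and int: "\<And>i j. i < n \<Longrightarrow> j < n \<Longrightarrow> A $$ (i, j) \<in> \<int>"
    and k: "eigenvalue A k"
  shows "algebraic_int k"
proof -
  define B where "B = mat n n (\<lambda>(i, j). \<lfloor>Re (A $$ (i, j))\<rfloor>)"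
  have B: "B \<in> carrier_mat n n" by (simp add: B_def)
  have "A = map_mat of_int B"
    using A int by (auto simp: B_def intro!: eq_matI)
      (metis Ints_cases Re_complex_of_real floor_of_int of_real_of_int_eq)
  then have "char_poly A = map_poly of_int (char_poly B)"
    using of_int_hom.char_poly_hom[OF B] by simp
  moreover have "lead_coeff (char_poly B) = 1"
    using degree_monic_char_poly[OF B] by simp
  ultimately show ?thesis
    using k unfolding eigenvalue_root_char_poly[OF A] algebraic_int_altdef_ipoly by metis
qed

lemma commuting_mats_common_eigenvector:
  fixes A B :: "complex mat"
  assumes A: "A \<in> carrier_mat n n" and B: "B \<in> carrier_mat n n" and comm: "A * B = B * A"
    and k: "eigenvalue A k"
  obtains X l where "X \<in> carrier_mat n n" "X \<noteq> 0\<^sub>m n n" "A * X = k \<cdot>\<^sub>m X" "B * X = l \<cdot>\<^sub>m X"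
proof -
  note assoc = assoc_mult_mat[of _ n n _ n _ n]
  obtain E m where E: "E \<in> carrier_mat n n" "E * E = E" "A * E = k \<cdot>\<^sub>m E"
    and tr: "mat_trace E = of_nat m" "m > 0"
    and proj: "\<And>X. X \<in> carrier_mat n n \<Longrightarrow> A * X = k \<cdot>\<^sub>m X \<Longrightarrow> E * X = X"
    using eigenspace_projection[OF A k] by blast
  \<comment> \<open>Shifting \<open>B\<close> makes its compression to the eigenspace non-nilpotent, so that it has an
    eigenvector for a nonzero eigenvalue, which necessarily lies in the eigenspace.\<close>
  obtain c :: complex where c: "mat_trace (B * E) + c * mat_trace E \<noteq> 0"
  proof (cases "mat_trace (B * E) = 0")
    case True
    then show thesis using that[of 1] tr by simp
  next
    case False
    then show thesis using that[of 0] by simp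
  qed
  define D where "D = B + c \<cdot>\<^sub>m 1\<^sub>m n"
  have D: "D \<in> carrier_mat n n" using B by (simp add: D_def)
  have D_mult: "D * X = B * X + c \<cdot>\<^sub>m X" if X: "X \<in> carrier_mat n n" for X
    unfolding D_def
    by (subst add_mult_distrib_mat[OF B _ X])
      (simp_all add: mult_smult_assoc_mat[OF one_carrier_mat X] left_mult_one_mat[OF X])
  have BE: "B * E \<in> carrier_mat n n" and DE: "D * E \<in> carrier_mat n n" using B D E by auto
  have "mat_trace (D * E) = mat_trace (B * E) + c * mat_trace E"
    unfolding D_mult[OF E(1)] using BE E(1) by (simp add: mat_trace_add[of _ n] mat_trace_smult)
  with c have "mat_trace (D * E) \<noteq> 0" by simp
  moreover obtain es where "length es = n" "mat_trace (D * E) = sum_list es"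
    and ev: "\<And>e. e \<in> set es \<Longrightarrow> eigenvalue (D * E) e"
    using mat_trace_eq_sum_eigenvalues[OF DE] by blast
  ultimately have "\<exists>e\<in>set es. e \<noteq> 0"
    using sum_list_neutral[of es] by auto
  then obtain e where e: "eigenvalue (D * E) e" "e \<noteq> 0" using ev by auto
  then obtain X where X: "X \<in> carrier_mat n n" "X \<noteq> 0\<^sub>m n n" "D * E * X = e \<cdot>\<^sub>m X"
    using eigenvalue_matE[OF DE] by blast
  \<comment> \<open>As \<open>B\<close> commutes with \<open>A\<close>, it preserves the eigenspace;
    hence \<open>E\<close> fixes \<open>B * E\<close>, and with it \<open>D * E\<close>.\<close>
  have "A * (B * E) = B * (A * E)"
    unfolding assoc[OF A B E(1), symmetric] comm by (rule assoc[OF B A E(1)])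
  also have "\<dots> = k \<cdot>\<^sub>m (B * E)"
    unfolding E(3) by (rule mult_smult_distrib[OF B E(1)])
  finally have ABE: "A * (B * E) = k \<cdot>\<^sub>m (B * E)" .
  have "E * (D * E) = E * (B * E) + E * (c \<cdot>\<^sub>m E)"
    unfolding D_mult[OF E(1)] using BE E(1) by (intro mult_add_distrib_mat) auto
  also have "\<dots> = D * E"
    unfolding proj[OF BE ABE] mult_smult_distrib[OF E(1) E(1)] E(2) D_mult[OF E(1)] ..
  finally have "E * (D * E) = D * E" .
  \<comment> \<open>Since \<open>e\<close> is nonzero, \<open>X\<close> is a multiple of
    \<open>D * E * X\<close>, which places its columns in the eigenspace.\<close>
  then have "E * (D * E * X) = D * E * X"
    using assoc[OF E(1) DE X(1)] by simp
  then have "e \<cdot>\<^sub>m (E * X) = e \<cdot>\<^sub>m X"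
    unfolding X(3) mult_smult_distrib[OF E(1) X(1)] .
  then have "inverse e \<cdot>\<^sub>m (e \<cdot>\<^sub>m (E * X)) = inverse e \<cdot>\<^sub>m (e \<cdot>\<^sub>m X)" by simp
  moreover have "inverse e \<cdot>\<^sub>m (e \<cdot>\<^sub>m Y) = Y" for Y
    using e(2) by (intro eq_matI) auto
  ultimately have EX: "E * X = X" by simp
  have "A * X = A * E * X" using assoc[OF A E(1) X(1)] EX by simp
  also have "\<dots> = k \<cdot>\<^sub>m X"
    unfolding E(3) mult_smult_assoc_mat[OF E(1) X(1)] EX ..
  finally have AX: "A * X = k \<cdot>\<^sub>m X" .
  have BX: "B * X \<in> carrier_mat n n" using B X by simp
  have eq: "e \<cdot>\<^sub>m X = B * X + c \<cdot>\<^sub>m X"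
    using X(3) assoc[OF D E(1) X(1)] EX D_mult[OF X(1)] by simp
  have "B * X = (e - c) \<cdot>\<^sub>m X"
  proof (rule eq_matI)
    fix i j assume "i < dim_row ((e - c) \<cdot>\<^sub>m X)" "j < dim_col ((e - c) \<cdot>\<^sub>m X)"
    then have ij: "i < n" "j < n" using X(1) by auto
    have "e * X $$ (i, j) = (e \<cdot>\<^sub>m X) $$ (i, j)" using ij X(1) by simp
    also have "\<dots> = (B * X) $$ (i, j) + c * X $$ (i, j)"
      unfolding eq using ij X(1) BX by simp
    finally have "(B * X) $$ (i, j) = e * X $$ (i, j) - c * X $$ (i, j)"
      by (metis add_diff_cancel_right')
    also have "\<dots> = ((e - c) \<cdot>\<^sub>m X) $$ (i, j)" using ij X(1) by (simp add: left_diff_distrib)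
    finally show "(B * X) $$ (i, j) = ((e - c) \<cdot>\<^sub>m X) $$ (i, j)" .
  next
    show "dim_row (B * X) = dim_row ((e - c) \<cdot>\<^sub>m X)" using B X(1) by simp
    show "dim_col (B * X) = dim_col ((e - c) \<cdot>\<^sub>m X)" by simp
  qed
  then show thesis by (rule that[OF X(1,2) AX])
qed

section \<open>Convolution matrices over a finite group\<close>

text \<open>The list fixes one common order of rows and columns and also forces the group to be
  finite.\<close>

locale enumerated_group = group G for G (structure) +
  fixes vs :: "'a list"
  assumes distinct_vs: "distinct vs" and set_vs: "set vs = carrier G"
begin

abbreviation n :: nat where "n \<equiv> length vs"

abbreviation gen :: "'a \<Rightarrow> 'a set" where "gen x \<equiv> generate G {x}"

text \<open>
  Right multiplication by the group algebra element \<open>\<Sum>x. c x \<cdot> x\<close>.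
\<close>

definition conv_mat :: "('a \<Rightarrow> complex) \<Rightarrow> complex mat" where
  "conv_mat c = mat n n (\<lambda>(i, j). c (inv (vs ! i) \<otimes> vs ! j))"

lemma conv_mat_carrier [simp]: "conv_mat c \<in> carrier_mat n n"
  by (simp add: conv_mat_def)

lemma finite_carrier: "finite (carrier G)"
  using set_vs by (metis List.finite_set)

lemma nth_vs_carrier [simp]: "i < n \<Longrightarrow> vs ! i \<in> carrier G"
  using set_vs nth_mem by blast

lemma sum_vs: "(\<Sum>i<n. f (vs ! i)) = (\<Sum>g\<in>carrier G. f g)"
  by (rule sum.reindex_bij_betw[OF bij_betw_nth]) (auto simp: distinct_vs set_vs)

lemma conv_mat_cong:
  assumes "\<And>x. x \<in> carrier G \<Longrightarrow> c x = d x"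
  shows "conv_mat c = conv_mat d"
  unfolding conv_mat_def by (rule cong_mat) (auto simp: assms)

lemma cancel_left [simp]:
  assumes "x \<in> carrier G" "y \<in> carrier G"
  shows "inv x \<otimes> (x \<otimes> y) = y" "x \<otimes> (inv x \<otimes> y) = y"
  using assms by (simp_all add: m_assoc[symmetric])

text \<open>Substituting \<open>h = inv (vs ! i) \<otimes> g\<close> in the matrix product yields
  the convolution of the two coefficient functions.\<close>

lemma conv_mat_mult:
  "conv_mat c * conv_mat d = conv_mat (\<lambda>x. \<Sum>h\<in>carrier G. c h * d (inv h \<otimes> x))"
proof (rule eq_matI)
  fix i k
  assume "i < dim_row (conv_mat (\<lambda>x. \<Sum>h\<in>carrier G. c h * d (inv h \<otimes> x)))"
    "k < dim_col (conv_mat (\<lambda>x. \<Sum>h\<in>carrier G. c h * d (inv h \<otimes> x)))"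
  then have ik: "i < n" "k < n" by (auto simp: conv_mat_def)
  then have vik: "vs ! i \<in> carrier G" "vs ! k \<in> carrier G" by auto
  have "(conv_mat c * conv_mat d) $$ (i, k) = (\<Sum>j<n. conv_mat c $$ (i, j) * conv_mat d $$ (j, k))"
    using ik by (intro index_mult_mat_sum) auto
  also have "\<dots> = (\<Sum>j<n. c (inv (vs ! i) \<otimes> vs ! j) * d (inv (vs ! j) \<otimes> vs ! k))"
    using ik by (intro sum.cong) (auto simp: conv_mat_def)
  also have "\<dots> = (\<Sum>g\<in>carrier G. c (inv (vs ! i) \<otimes> g) * d (inv g \<otimes> vs ! k))"
    by (rule sum_vs)
  also have "\<dots> = (\<Sum>h\<in>carrier G. c h * d (inv h \<otimes> (inv (vs ! i) \<otimes> vs ! k)))"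
    by (rule sum.reindex_bij_witness[where i = "\<lambda>h. vs ! i \<otimes> h" and j = "\<lambda>g. inv (vs ! i) \<otimes> g"])
      (use vik in \<open>auto simp: m_assoc inv_mult_group\<close>)
  finally show "(conv_mat c * conv_mat d) $$ (i, k) =
      conv_mat (\<lambda>x. \<Sum>h\<in>carrier G. c h * d (inv h \<otimes> x)) $$ (i, k)"
    using ik by (simp add: conv_mat_def)
qed (simp_all add: conv_mat_def)

text \<open>Substituting \<open>k = inv h \<otimes> x\<close> puts the factor \<open>d k\<close>
  first in both convolutions. They then differ only in \<open>c (x \<otimes> inv k)\<close> against
  \<open>c (inv k \<otimes> x)\<close>, and only on the support of \<open>d\<close>.\<close>

lemma conv_mat_commute:
  assumes "\<And>x k. x \<in> carrier G \<Longrightarrow> k \<in> carrier G \<Longrightarrow> d k \<noteq> 0 \<Longrightarrow> c (x \<otimes> inv k) = c (inv k \<otimes> x)"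
  shows "conv_mat c * conv_mat d = conv_mat d * conv_mat c"
  unfolding conv_mat_mult
proof (rule conv_mat_cong)
  fix x assume x: "x \<in> carrier G"
  have "(\<Sum>h\<in>carrier G. c h * d (inv h \<otimes> x)) = (\<Sum>k\<in>carrier G. d k * c (x \<otimes> inv k))"
    by (rule sum.reindex_bij_witness[where i = "\<lambda>k. x \<otimes> inv k" and j = "\<lambda>h. inv h \<otimes> x"])
      (use x in \<open>auto simp: m_assoc inv_mult_group\<close>)
  also have "\<dots> = (\<Sum>k\<in>carrier G. d k * c (inv k \<otimes> x))"
    using assms x by (intro sum.cong) auto
  finally show "(\<Sum>h\<in>carrier G. c h * d (inv h \<otimes> x)) = (\<Sum>h\<in>carrier G. d h * c (inv h \<otimes> x))" .
qed

text \<open>Conjugation by \<open>k\<close> turns \<open>x \<otimes> inv k\<close> into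
  \<open>inv k \<otimes> x\<close>. With \<open>H\<close> the whole group this is centrality; with a
  smaller \<open>H\<close> it covers the averages over subgroups of \<open>H\<close>.\<close>

lemma conv_mat_indicator_commute:
  assumes H: "subgroup H G" and conj: "\<And>t h. t \<in> T \<Longrightarrow> h \<in> H \<Longrightarrow> inv h \<otimes> t \<otimes> h \<in> T"
    and d: "\<And>k. k \<in> carrier G \<Longrightarrow> d k \<noteq> 0 \<Longrightarrow> k \<in> H"
  shows "conv_mat (indicator T) * conv_mat d = conv_mat d * conv_mat (indicator T)"
proof (rule conv_mat_commute)
  fix x k assume x: "x \<in> carrier G" and k: "k \<in> carrier G" "d k \<noteq> 0"
  have kH: "k \<in> H" using d k .
  have "x \<otimes> inv k \<in> T \<longleftrightarrow> inv k \<otimes> x \<in> T"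
  proof
    assume "x \<otimes> inv k \<in> T"
    from conj[OF this kH] show "inv k \<otimes> x \<in> T" using x k(1) by (simp add: m_assoc)
  next
    assume "inv k \<otimes> x \<in> T"
    from conj[OF this subgroup.m_inv_closed[OF H kH]] show "x \<otimes> inv k \<in> T"
      using x k(1) by (simp add: m_assoc)
  qed
  then show "indicator T (x \<otimes> inv k) = (indicator T (inv k \<otimes> x) :: complex)"
    by (simp add: indicator_def)
qed

text \<open>Each of the \<open>card C\<close> elements \<open>h\<close> of \<open>C\<close>
  contributes \<open>indicator C x\<close>. After division by \<open>card C\<close> the matrix is
  idempotent: it averages over \<open>C\<close>.\<close>

lemma conv_mat_subgroup_square:
  assumes "subgroup C G"
  shows "conv_mat (indicator C) * conv_mat (indicator C) =
    of_nat (card C) \<cdot>\<^sub>m conv_mat (indicator C)"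
proof -
  interpret C: subgroup C G by fact
  have *: "(\<Sum>h\<in>carrier G. indicator C h * indicator C (inv h \<otimes> x)) =
      (of_nat (card C) * indicator C x :: complex)"
    if x: "x \<in> carrier G" for x
  proof -
    have "indicator C h * indicator C (inv h \<otimes> x) = (indicator C h * indicator C x :: complex)"
      if h: "h \<in> carrier G" for h
    proof (cases "h \<in> C")
      case True
      have "inv h \<otimes> x \<in> C \<longleftrightarrow> x \<in> C"
      proof
        assume "inv h \<otimes> x \<in> C"
        then have "h \<otimes> (inv h \<otimes> x) \<in> C" using True by blast
        then show "x \<in> C" using h x by (simp add: m_assoc[symmetric])
      qed (use True in auto)
      then show ?thesis by (simp add: indicator_def)
    qed simp
    then have "(\<Sum>h\<in>carrier G. indicator C h * indicator C (inv h \<otimes> x)) =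
        (\<Sum>h\<in>carrier G. indicator C h * indicator C x :: complex)"
      by (intro sum.cong) auto
    also have "\<dots> = of_nat (card (carrier G \<inter> C)) * indicator C x"
      using finite_carrier by (simp add: sum_distrib_right[symmetric]) (simp add: indicator_def)
    also have "carrier G \<inter> C = C" using C.subset by blast
    finally show ?thesis .
  qed
  show ?thesis unfolding conv_mat_mult
    by (subst conv_mat_cong[OF *]) (auto simp: conv_mat_def intro!: eq_matI)
qed

section \<open>Traces against a projection\<close>

text \<open>The trace is linear and \<open>indicator T\<close> is a sum of point indicators. The
  weight \<open>w x\<close> is the trace of right translation by \<open>x\<close> times
  \<open>E\<close>; when the image of \<open>E\<close> is invariant under a subgroup,
  \<open>w\<close> is on that subgroup a character value. The same \<open>w\<close> serves all
  \<open>T\<close>.\<close>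

lemma trace_conv_mat_mult:
  assumes E: "E \<in> carrier_mat n n"
  obtains w where "\<And>T. T \<subseteq> carrier G \<Longrightarrow> mat_trace (conv_mat (indicator T) * E) = (\<Sum>x\<in>T. w x)"
proof
  fix T assume T: "T \<subseteq> carrier G"
  define w where "w x = (\<Sum>i<n. \<Sum>j<n. if inv (vs ! i) \<otimes> vs ! j = x then E $$ (j, i) else 0)" for x
  have "(\<Sum>x\<in>T. w x) = (\<Sum>i<n. \<Sum>x\<in>T. \<Sum>j<n. if inv (vs ! i) \<otimes> vs ! j = x then E $$ (j, i) else 0)"
    unfolding w_def by (rule sum.swap)
  also have "\<dots> = (\<Sum>i<n. \<Sum>j<n. \<Sum>x\<in>T. if inv (vs ! i) \<otimes> vs ! j = x then E $$ (j, i) else 0)"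
    by (intro sum.cong[OF refl] sum.swap)
  also have "\<dots> = (\<Sum>i<n. \<Sum>j<n. conv_mat (indicator T) $$ (i, j) * E $$ (j, i))"
    using finite_subset[OF T finite_carrier]
    by (intro sum.cong[OF refl]) (simp add: conv_mat_def indicator_def)
  also have "\<dots> = mat_trace (conv_mat (indicator T) * E)"
    using E by (subst mat_trace_mult[of _ n n]) auto
  finally show "mat_trace (conv_mat (indicator T) * E) =
      (\<Sum>x\<in>T. \<Sum>i<n. \<Sum>j<n. if inv (vs ! i) \<otimes> vs ! j = x then E $$ (j, i) else 0)"
    unfolding w_def by simp
qed

text \<open>Averaging over \<open>C\<close> preserves the image of \<open>E\<close>, so its
  compression \<open>P\<close> is again idempotent and has a natural number \<open>m\<close> as
  trace. The trace in question is \<open>card C * m\<close>.\<close>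

lemma trace_conv_mat_subgroup_rational:
  assumes E: "E \<in> carrier_mat n n" "E * E = E" and C: "subgroup C G"
    and inv: "E * (conv_mat (indicator C) * E) = conv_mat (indicator C) * E"
  shows "mat_trace (conv_mat (indicator C) * E) \<in> \<rat>"
proof -
  note assoc = assoc_mult_mat[of _ n n _ n _ n]
  define Q where "Q = conv_mat (indicator C)"
  define c :: complex where "c = of_nat (card C)"
  have Q: "Q \<in> carrier_mat n n" and QE: "Q * E \<in> carrier_mat n n"
    using mult_carrier_mat[OF conv_mat_carrier E(1)] by (auto simp: Q_def)
  interpret C: subgroup C G by fact
  have "card C \<noteq> 0"
    using finite_subset[OF C.subset finite_carrier] C.one_closed by (metis card_eq_0_iff empty_iff)
  then have c0: "c \<noteq> 0" by (simp add: c_def)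
  have "Q * E * (Q * E) = Q * (Q * E)"
    unfolding assoc[OF Q E(1) QE] using inv by (simp add: Q_def)
  also have "\<dots> = c \<cdot>\<^sub>m (Q * E)"
    unfolding assoc[OF Q Q E(1), symmetric] mult_smult_assoc_mat[OF Q E(1), symmetric]
    using conv_mat_subgroup_square[OF C] by (simp add: Q_def c_def)
  finally have QEQE: "Q * E * (Q * E) = c \<cdot>\<^sub>m (Q * E)" .
  define P where "P = (1 / c) \<cdot>\<^sub>m (Q * E)"
  have P: "P \<in> carrier_mat n n" using QE by (simp add: P_def)
  have "P * P = (1 / c) \<cdot>\<^sub>m ((1 / c) \<cdot>\<^sub>m (c \<cdot>\<^sub>m (Q * E)))"
    unfolding QEQE[symmetric] P_def mult_smult_assoc_mat[OF QE smult_carrier_mat[OF QE]]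
      mult_smult_distrib[OF QE QE] ..
  also have "\<dots> = P"
    unfolding P_def using c0 QE by (intro eq_matI) (auto simp del: index_mult_mat(1))
  finally have "P * P = P" .
  then obtain m where "mat_trace P = of_nat m"
    using idempotent_mat_trace[OF P] by blast
  then have "(1 / c) * mat_trace (Q * E) = of_nat m"
    unfolding P_def mat_trace_smult[OF QE] .
  then have "mat_trace (Q * E) = of_nat (card C * m)"
    using c0 by (simp add: field_simps c_def)
  then show ?thesis by (simp add: Q_def)
qed

section \<open>Sums over the generators of cyclic subgroups\<close>

lemma gen_subset:
  assumes "y \<in> gen x" "x \<in> carrier G"
  shows "gen y \<subseteq> gen x"
  using assms generate_subgroup_incl[of "{y}" "gen x"] generate_is_subgroup[of "{x}"] by auto

lemma gen_self: "x \<in> gen x"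
  by (rule generate.incl) simp

lemma gen_incl: "x \<in> carrier G \<Longrightarrow> gen x \<subseteq> carrier G"
  by (rule generate_incl) simp

text \<open>The elements of a cyclic group are partitioned according to the subgroup they generate.
  The classes of proper subgroups have rational sums by induction on the order, and subtracting them
  from the total leaves the class of generators.\<close>

lemma sum_gen_class_rational:
  fixes w :: "'a \<Rightarrow> complex"
  assumes "\<And>y. y \<in> gen x \<Longrightarrow> (\<Sum>z\<in>gen y. w z) \<in> \<rat>" and "x \<in> carrier G"
  shows "(\<Sum>y | y \<in> carrier G \<and> gen y = gen x. w y) \<in> \<rat>"
  using assms
proof (induction "card (gen x)" arbitrary: x rule: less_induct)
  case less
  have fin: "finite (gen x)"
    using finite_subset[OF gen_incl[OF less.prems(2)] finite_carrier] .
  \<comment> \<open>Every generator of \<open>gen z\<close> already lies in \<open>gen x\<close>, so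
    the fibres of \<open>gen\<close> inside \<open>gen x\<close> are complete classes.\<close>
  have cls: "{y. y \<in> gen x \<and> gen y = gen z} = {y. y \<in> carrier G \<and> gen y = gen z}"
    if z: "z \<in> gen x" for z
    using gen_subset[OF z less.prems(2)] gen_incl[OF less.prems(2)] gen_self by blast
  have rat: "(\<Sum>y | y \<in> carrier G \<and> gen y = D. w y) \<in> \<rat>" if D: "D \<in> gen ` gen x - {gen x}" for D
  proof -
    obtain z where z: "z \<in> gen x" "D = gen z" "gen z \<noteq> gen x" using D by blast
    note sub = gen_subset[OF z(1) less.prems(2)]
    have "card (gen z) < card (gen x)"
      using sub z(3) fin by (intro psubset_card_mono) auto
    then show ?thesis unfolding z(2)
    proof (rule less.hyps)
      show "z \<in> carrier G" using z(1) gen_incl[OF less.prems(2)] by blast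
      show "(\<Sum>z\<in>gen y. w z) \<in> \<rat>" if "y \<in> gen z" for y
        using that sub less.prems(1) by blast
    qed
  qed
  have "(\<Sum>y\<in>gen x. w y) = (\<Sum>D\<in>gen ` gen x. \<Sum>y | y \<in> gen x \<and> gen y = D. w y)"
    by (rule sum.image_gen[OF fin])
  also have "\<dots> = (\<Sum>D\<in>gen ` gen x. \<Sum>y | y \<in> carrier G \<and> gen y = D. w y)"
    by (rule sum.cong) (auto simp: cls)
  also have "\<dots> = (\<Sum>y | y \<in> carrier G \<and> gen y = gen x. w y) +
      (\<Sum>D\<in>gen ` gen x - {gen x}. \<Sum>y | y \<in> carrier G \<and> gen y = D. w y)"
    using fin gen_self[of x] by (intro sum.remove) auto
  finally have "(\<Sum>y | y \<in> carrier G \<and> gen y = gen x. w y) = (\<Sum>y\<in>gen x. w y) -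
      (\<Sum>D\<in>gen ` gen x - {gen x}. \<Sum>y | y \<in> carrier G \<and> gen y = D. w y)"
    by simp
  also have "\<dots> \<in> \<rat>"
    by (rule Rats_diff[OF less.prems(1)[OF gen_self] Rats_sum[OF rat]])
  finally show ?case .
qed

text \<open>The fibres of \<open>gen\<close> on \<open>T\<close> are complete classes of generators,
  each with a rational sum.\<close>

lemma sum_eulerian_rational:
  fixes w :: "'a \<Rightarrow> complex"
  assumes T: "T \<subseteq> carrier G" "\<And>t x. t \<in> T \<Longrightarrow> x \<in> carrier G \<Longrightarrow> gen x = gen t \<Longrightarrow> x \<in> T"
    and w: "\<And>t y. t \<in> T \<Longrightarrow> y \<in> gen t \<Longrightarrow> (\<Sum>z\<in>gen y. w z) \<in> \<rat>"
  shows "(\<Sum>t\<in>T. w t) \<in> \<rat>"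
proof -
  have "(\<Sum>t\<in>T. w t) = (\<Sum>D\<in>gen ` T. \<Sum>y | y \<in> T \<and> gen y = D. w y)"
    by (rule sum.image_gen[OF finite_subset[OF T(1) finite_carrier]])
  also have "\<dots> \<in> \<rat>"
  proof (rule Rats_sum)
    fix D assume "D \<in> gen ` T"
    then obtain t where t: "t \<in> T" "D = gen t" by blast
    then have "{y. y \<in> T \<and> gen y = D} = {y. y \<in> carrier G \<and> gen y = gen t}"
      using T by blast
    then show "(\<Sum>y | y \<in> T \<and> gen y = D. w y) \<in> \<rat>"
      using sum_gen_class_rational[of t w] w t T(1) by auto
  qed
  finally show ?thesis .
qed

section \<open>Integrality of eigenvalues and the Cayley graph\<close>

lemma eulerian_conv_mat_eigenvalue_int:
  assumes H: "subgroup H G" and T: "T \<subseteq> H"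
    and eul: "\<And>t x. t \<in> T \<Longrightarrow> x \<in> carrier G \<Longrightarrow> gen x = gen t \<Longrightarrow> x \<in> T"
    and conj: "\<And>t h. t \<in> T \<Longrightarrow> h \<in> H \<Longrightarrow> inv h \<otimes> t \<otimes> h \<in> T"
    and k: "eigenvalue (conv_mat (indicator T)) k"
  shows "k \<in> \<int>"
proof -
  note assoc = assoc_mult_mat[of _ n n _ n _ n]
  interpret H: subgroup H G by fact
  have TG: "T \<subseteq> carrier G" using T H.subset by blast
  define A where "A = conv_mat (indicator T)"
  have A: "A \<in> carrier_mat n n" by (simp add: A_def)
  obtain E m where E: "E \<in> carrier_mat n n" "E * E = E" "A * E = k \<cdot>\<^sub>m E"
    and tr: "mat_trace E = of_nat m" "m > 0"
    and proj: "\<And>X. X \<in> carrier_mat n n \<Longrightarrow> A * X = k \<cdot>\<^sub>m X \<Longrightarrow> E * X = X"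
    using eigenspace_projection[OF A k[folded A_def]] by blast
  obtain w where w: "\<And>T. T \<subseteq> carrier G \<Longrightarrow> mat_trace (conv_mat (indicator T) * E) = (\<Sum>x\<in>T. w x)"
    using trace_conv_mat_mult[OF E(1)] by blast
  have sub_rat: "(\<Sum>x\<in>C. w x) \<in> \<rat>" if C: "subgroup C G" "C \<subseteq> H" for C
  proof -
    interpret C: subgroup C G by (rule C)
    define Q where "Q = conv_mat (indicator C)"
    have Q: "Q \<in> carrier_mat n n" and QE: "Q * E \<in> carrier_mat n n"
    using mult_carrier_mat[OF conv_mat_carrier E(1)] by (auto simp: Q_def)
    have "A * Q = Q * A"
      unfolding A_def Q_def using C(2)
      by (intro conv_mat_indicator_commute[OF H conj]) (auto simp: indicator_def)
    \<comment> \<open>Commuting with \<open>A\<close> makes \<open>Q\<close> preserve the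
      eigenspace, so \<open>E\<close> fixes \<open>Q * E\<close> and the rationality of its trace
      applies.\<close>
    then have "A * (Q * E) = Q * (A * E)"
      using assoc[OF A Q E(1)] assoc[OF Q A E(1)] by simp
    also have "\<dots> = k \<cdot>\<^sub>m (Q * E)"
      unfolding E(3) by (rule mult_smult_distrib[OF Q E(1)])
    finally have "E * (Q * E) = Q * E" by (rule proj[OF QE])
    then have "mat_trace (Q * E) \<in> \<rat>"
      unfolding Q_def by (rule trace_conv_mat_subgroup_rational[OF E(1,2) C(1)])
    then show ?thesis using w[OF C.subset] by (simp add: Q_def)
  qed
  have "(\<Sum>t\<in>T. w t) \<in> \<rat>"
  proof (rule sum_eulerian_rational[OF TG eul])
    fix t y assume t: "t \<in> T" and y: "y \<in> gen t"
    have "gen t \<subseteq> H"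
      using t T H by (intro generate_subgroup_incl) auto
    moreover have "gen y \<subseteq> gen t" using gen_subset[OF y] t TG by blast
    moreover have "y \<in> carrier G" using y t TG gen_incl by blast
    ultimately show "(\<Sum>z\<in>gen y. w z) \<in> \<rat>"
      by (intro sub_rat generate_is_subgroup) auto
  qed
  \<comment> \<open>This trace is read in two ways: as the sum of \<open>w\<close> over
    \<open>T\<close>, and as \<open>k\<close> times the dimension \<open>m\<close> of the
    eigenspace.\<close>
  then have "mat_trace (A * E) \<in> \<rat>" using w[OF TG] by (simp add: A_def)
  then have "k * of_nat m \<in> \<rat>" unfolding E(3) mat_trace_smult[OF E(1)] tr .
  then have "k * of_nat m / of_nat m \<in> \<rat>" by (rule Rats_divide) simp
  then have "k \<in> \<rat>" using tr(2) by simp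
  moreover have "algebraic_int k"
    using eigenvalue_algebraic_int[OF A _ k[folded A_def]] by (simp add: A_def conv_mat_def indicator_def)
  ultimately show ?thesis by (rule rational_algebraic_int_is_int[rotated])
qed

lemma adjacency_matrix_cayley_graph:
  assumes "S \<subseteq> carrier G"
  shows "adjacency_matrix (cayley_graph G S) vs = conv_mat (indicator S)"
proof -
  have "(g, h) \<in> parcs (cayley_graph G S) \<longleftrightarrow> inv g \<otimes> h \<in> S" if "g \<in> carrier G" "h \<in> carrier G" for g h
  proof
    assume "(g, h) \<in> parcs (cayley_graph G S)"
    then obtain s where "s \<in> S" "h = g \<otimes> s" by (auto simp: cayley_graph_def)
    then show "inv g \<otimes> h \<in> S" using that assms by (auto simp: m_assoc[symmetric])
  next
    assume "inv g \<otimes> h \<in> S"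
    moreover have "h = g \<otimes> (inv g \<otimes> h)" using that by (simp add: m_assoc[symmetric])
    ultimately show "(g, h) \<in> parcs (cayley_graph G S)"
      using that(1) by (auto simp: cayley_graph_def)
  qed
  then show ?thesis
    unfolding adjacency_matrix_def conv_mat_def by (intro cong_mat) (auto simp: indicator_def)
qed

end

theorem mainTheorem3:
  fixes G :: "('a, 'b) monoid_scheme" and R H S :: "'a set"
  assumes "group G" and "finite (carrier G)"
    and "eulerian_subset G R" and "normal_subset G R"
    and "subgroup H G"
    and "S = R - (R \<inter> H)"
  shows "integral_graph (cayley_graph G S)"
  unfolding integral_graph_def
proof (intro allI impI)
  fix vs k
  assume vs: "distinct vs \<and> set vs = pverts (cayley_graph G S)"
    and k: "eigenvalue (adjacency_matrix (cayley_graph G S) vs) k"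
  interpret group G by fact
  interpret enumerated_group G vs
    using vs by unfold_locales (auto simp: cayley_graph_def)
  interpret H: subgroup H G by fact
  have R: "R \<subseteq> carrier G" and S: "S \<subseteq> carrier G"
    using assms(3,6) by (auto simp: eulerian_subset_def)
  have eul: "x \<in> R" if "r \<in> R" "x \<in> carrier G" "generate G {x} = generate G {r}" for r x
    using that assms(3) by (auto simp: eulerian_subset_def)
  have conj: "inv\<^bsub>G\<^esub> g \<otimes>\<^bsub>G\<^esub> r \<otimes>\<^bsub>G\<^esub> g \<in> R" if "r \<in> R" "g \<in> carrier G" for r g
    using that assms(4) by (auto simp: normal_subset_def)
  define A where "A T = conv_mat (indicator T)" for T :: "'a set"
  have A [simp]: "A T \<in> carrier_mat (length vs) (length vs)" for T by (simp add: A_def)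
  \<comment> \<open>Normality of \<open>R\<close> makes \<open>A R\<close> central, so the
    eigenvalue \<open>k\<close> of \<open>A S\<close> is realised on a common eigenvector, with
    eigenvalue \<open>l\<close> for \<open>A R\<close>. It remains to show that \<open>l\<close> and
    \<open>l - k\<close> are integers.\<close>
  have "A R * A S = A S * A R"
    unfolding A_def by (rule conv_mat_indicator_commute[OF subgroup_self conj])
  moreover have "eigenvalue (A S) k"
    using k unfolding adjacency_matrix_cayley_graph[OF S] A_def .
  ultimately obtain X l where X: "X \<in> carrier_mat (length vs) (length vs)"
      "X \<noteq> 0\<^sub>m (length vs) (length vs)" "A S * X = k \<cdot>\<^sub>m X" "A R * X = l \<cdot>\<^sub>m X"
    using commuting_mats_common_eigenvector[OF A A, of S R k] by metis
  have "A (R \<inter> H) = A R - A S"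
    using assms(6) by (auto simp: A_def conv_mat_def indicator_def intro!: eq_matI)
  then have "A (R \<inter> H) * X = l \<cdot>\<^sub>m X - k \<cdot>\<^sub>m X"
    using minus_mult_distrib_mat[OF A A X(1)] X(3,4) by simp
  also have "\<dots> = (l - k) \<cdot>\<^sub>m X"
    using X(1) by (intro eq_matI) (auto simp: left_diff_distrib)
  finally have "eigenvalue (A (R \<inter> H)) (l - k)"
    by (rule eigenvalue_matI[OF A X(1,2)])
  then have "l - k \<in> \<int>"
    unfolding A_def
  proof (rule eulerian_conv_mat_eigenvalue_int[OF assms(5), rotated -1])
    show "x \<in> R \<inter> H" if "t \<in> R \<inter> H" "x \<in> carrier G" "gen x = gen t" for t x
    proof -
      \<comment> \<open>An element generating the same cyclic group as \<open>t\<close> lies in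
        \<open>gen t\<close>, hence in \<open>H\<close>: intersecting with a subgroup keeps the set
        Eulerian.\<close>
      have "gen t \<subseteq> H" using that(1) assms(5) by (intro generate_subgroup_incl) auto
      then show ?thesis using that eul[of t x] gen_self[of x] by auto
    qed
    show "inv\<^bsub>G\<^esub> h \<otimes>\<^bsub>G\<^esub> t \<otimes>\<^bsub>G\<^esub> h \<in> R \<inter> H" if "t \<in> R \<inter> H" "h \<in> H" for t h
      using that conj[of t h] by auto
  qed auto
  moreover have "l \<in> \<int>"
  proof (rule eulerian_conv_mat_eigenvalue_int[OF subgroup_self R])
    show "eigenvalue (conv_mat (indicator R)) l"
      using eigenvalue_matI[OF A X(1,2,4)] unfolding A_def .
  qed (use eul conj in auto)
  ultimately have "l - (l - k) \<in> \<int>" by (rule Ints_diff[rotated])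
  then show "k \<in> \<int>" by simp
qed

end
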